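(* Let the cost function $\mathrm{cost}$ on refinement queries $Q=(C',B)$ be given by $$\mathrm{cost}(Q)=|C'|\cdot |B|\cdot (1-\mathrm{Var}(B))$$ (with the convention that $\mathrm{cost}(Q)=0$ whenever $|B|\le 1$ or $|C'|\le 1$). Then $\mathrm{cost}$ satisfies all four of the axioms Empty questions, Prefix monotonicity, Multiple monotonicity and Variance monotonicity.
   Context: A refinement query is a pair $Q=(C',B)$ where $C'$ is a finite set of candidates (a subset of some finite candidate set $C$) and $B=(b_1,\ldots,b_\ell)$ is a vector of real numbers with $1\le \ell\le |C'|$, $0<b_j\le 1$ for all $j$, and $\sum_{j=1}^{\ell} b_j=1$. Write $|B|=\ell$ for the length of $B$. The query space $\Omega$ consists of all refinement queries, and a cost function is a map $\mathrm{cost}:\Omega\to\mathbb{R}_{\ge 0}$. Variance: $\mathrm{Var}(B)=0$ if $|B|\in\{0,1\}$, and $\mathrm{Var}(B)=\frac{1}{|B|}\sum_{j=1}^{|B|}\left(b_j-\frac{1}{|B|}\right)^2$ if $|B|>1$. For a number $c$, $c\cdot B$ denotes the vector $(cb_1,\ldots,cb_\ell)$. A vector $u$ is a nontrivial prefix of a vector $v$ if $|u|<|v|$ (lengths) and $u_i=v_i$ for every $i\in\{1,\dots,|u|\}$. A query $Q'=(C'',B)$ is a multiple of the query $Q=(C',B)$ by $l\in\mathbb{N}$ if $|C''|=l\cdot|C'|$ (the vector $B$ is the same in both). Axioms for a cost function: (Empty questions) For each query $Q=(C',B)$ with $|B|\in\{0,1\}$ or $|C'|\in\{0,1\}$, $\mathrm{cost}(Q)=0$.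 (Prefix monotonicity) For all queries $Q=(C',B)$ with $|B|\neq 0$ and $Q'=(C'',B')$ with $|B'|\ne 1$, if $|C'|\cdot B$ is a nontrivial prefix of $|C''|\cdot B'$, then $\mathrm{cost}(Q)<\mathrm{cost}(Q')$. (Multiple monotonicity) For all queries $Q,Q'$ and $l\in\mathbb{N}$ such that $Q'$ is the multiple of $Q$ by $l$, $\mathrm{cost}(Q')\ge l\cdot\mathrm{cost}(Q)$. (Variance monotonicity) For all queries $Q=(C',B)$ and $Q'=(C',B')$ with the same $C'$ and $|B|=|B'|$, if $\mathrm{Var}(B)>\mathrm{Var}(B')$ then $\mathrm{cost}(Q)<\mathrm{cost}(Q')$. *)

theory Defs
  imports Complex_Main "HOL-Library.Sublist"
begin

text \<open>
  Vectors of real numbers are lists, so the entries \<open>b\<^sub>1, \<dots>, b\<^sub>l\<close> of \<open>B\<close> are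
  \<open>B ! 0, \<dots>, B ! (length B - 1)\<close>. Candidates are elements of an arbitrary type.
\<close>

type_synonym 'a query = "'a set \<times> real list"

text \<open>
  The ambient finite candidate set is not fixed: a set is contained in some finite set
  of candidates iff it is finite.
\<close>

definition query_space :: "'a query set" where
  "query_space = {(C', B). finite C' \<and> 1 \<le> length B \<and> length B \<le> card C' \<and>
     (\<forall>j<length B. 0 < B ! j \<and> B ! j \<le> 1) \<and> (\<Sum>j<length B. B ! j) = 1}"

definition Var :: "real list \<Rightarrow> real" where
  "Var B = (if length B \<le> 1 then 0
     else 1 / real (length B) * (\<Sum>j<length B. (B ! j - 1 / real (length B))\<^sup>2))"

definition scale :: "real \<Rightarrow> real list \<Rightarrow> real list" where
  "scale c B = map (\<lambda>b. c * b) B"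

definition nontrivial_prefix :: "real list \<Rightarrow> real list \<Rightarrow> bool" where
  "nontrivial_prefix u v \<longleftrightarrow> length u < length v \<and> (\<forall>i<length u. u ! i = v ! i)"

lemma nontrivial_prefix_iff_strict_prefix: "nontrivial_prefix u v \<longleftrightarrow> strict_prefix u v"
proof
  assume "nontrivial_prefix u v"
  then have len: "length u < length v" and nth: "\<forall>i<length u. u ! i = v ! i"
    by (auto simp: nontrivial_prefix_def)
  then have "take (length u) v = u"
    by (intro nth_equalityI) auto
  then have "prefix u v"
    by (metis take_is_prefix)
  with len show "strict_prefix u v"
    by (auto simp: strict_prefix_def)
next
  assume "strict_prefix u v"
  then show "nontrivial_prefix u v"
    by (auto simp: nontrivial_prefix_def strict_prefix_def prefix_def nth_append)
qed

definition is_multiple :: "'a query \<Rightarrow> 'a query \<Rightarrow> nat \<Rightarrow> bool" where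
  "is_multiple Q' Q l \<longleftrightarrow> card (fst Q') = l * card (fst Q) \<and> snd Q' = snd Q"

text \<open>
  Cost functions are total HOL functions; only their values on \<^const>\<open>query_space\<close> matter.
\<close>

definition cost_function :: "('a query \<Rightarrow> real) \<Rightarrow> bool" where
  "cost_function cost \<longleftrightarrow> (\<forall>Q\<in>query_space. 0 \<le> cost Q)"

definition empty_questions :: "('a query \<Rightarrow> real) \<Rightarrow> bool" where
  "empty_questions cost \<longleftrightarrow>
     (\<forall>C' B. (C', B) \<in> query_space \<longrightarrow> length B \<in> {0, 1} \<or> card C' \<in> {0, 1} \<longrightarrow>
        cost (C', B) = 0)"

definition prefix_monotonicity :: "('a query \<Rightarrow> real) \<Rightarrow> bool" where
  "prefix_monotonicity cost \<longleftrightarrow>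
     (\<forall>C' B C'' B'. (C', B) \<in> query_space \<longrightarrow> (C'', B') \<in> query_space \<longrightarrow>
        length B \<noteq> 0 \<longrightarrow> length B' \<noteq> 1 \<longrightarrow>
        nontrivial_prefix (scale (real (card C')) B) (scale (real (card C'')) B') \<longrightarrow>
        cost (C', B) < cost (C'', B'))"

definition multiple_monotonicity :: "('a query \<Rightarrow> real) \<Rightarrow> bool" where
  "multiple_monotonicity cost \<longleftrightarrow>
     (\<forall>Q\<in>query_space. \<forall>Q'\<in>query_space. \<forall>l::nat.
        is_multiple Q' Q l \<longrightarrow> cost Q' \<ge> real l * cost Q)"

definition variance_monotonicity :: "('a query \<Rightarrow> real) \<Rightarrow> bool" where
  "variance_monotonicity cost \<longleftrightarrow>
     (\<forall>C' B B'. (C', B) \<in> query_space \<longrightarrow> (C', B') \<in> query_space \<longrightarrow>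
        length B = length B' \<longrightarrow> Var B > Var B' \<longrightarrow> cost (C', B) < cost (C', B'))"

end

theory Submission
  imports Defs
begin

text \<open>
  For a query with \<open>l = |B|\<close> we have \<open>0 \<le> l * Var B < 1\<close>, the upper bound because
  \<open>l * Var B = (\<Sum>j. b\<^sub>j\<^sup>2) - 1 / l\<close> and \<open>b\<^sub>j\<^sup>2 \<le> b\<^sub>j\<close>. With \<open>m = |C'|\<close> and \<open>l \<ge> 2\<close>
  the cost therefore lies in the interval from \<open>m * (l - 1)\<close> (excluded) to \<open>m * l\<close>. A nontrivial
  prefix has smaller \<open>l\<close>, and by comparing entry sums its \<open>m\<close> is not larger, so the
  intervals of the two costs do not overlap.
\<close>

lemma Var_nonneg: "0 \<le> Var B"
  by (simp add: Var_def sum_nonneg)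

text \<open>Expand the square: since the entries sum to 1, the cross terms contribute
  \<open>- 2 / l\<close> and the constant terms \<open>1 / l\<close>, where
  \<open>l = length B\<close>.\<close>

lemma length_mult_Var:
  assumes "1 < length B" and "(\<Sum>j<length B. B ! j) = 1"
  shows "real (length B) * Var B = (\<Sum>j<length B. (B ! j)\<^sup>2) - 1 / real (length B)"
proof -
  define l where "l = real (length B)"
  have l: "l > 0"
    using assms(1) unfolding l_def by linarith
  have "l * Var B = (\<Sum>j<length B. (B ! j - 1 / l)\<^sup>2)"
    using assms(1) by (simp add: Var_def l_def)
  also have "\<dots> = (\<Sum>j<length B. (B ! j)\<^sup>2 - 2 / l * B ! j + 1 / l\<^sup>2)"
    by (intro sum.cong) (auto simp: power2_diff power_divide)
  also have "\<dots> = (\<Sum>j<length B. (B ! j)\<^sup>2) - 2 / l * (\<Sum>j<length B. B ! j) + l * (1 / l\<^sup>2)"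
    by (simp add: sum.distrib sum_subtractf sum_distrib_left l_def)
  also have "\<dots> = (\<Sum>j<length B. (B ! j)\<^sup>2) - 1 / l"
    using l assms(2) by (simp add: field_simps power2_eq_square)
  finally show ?thesis
    by (simp add: l_def)
qed

lemma length_mult_Var_less_1:
  assumes "(C', B) \<in> query_space"
  shows "real (length B) * Var B < 1"
proof (cases "1 < length B")
  case True
  have "(\<Sum>j<length B. (B ! j)\<^sup>2) \<le> (\<Sum>j<length B. B ! j)"
    using assms by (intro sum_mono) (auto simp: query_space_def power2_eq_square mult_left_le)
  moreover have "(\<Sum>j<length B. B ! j) = 1"
    using assms by (simp add: query_space_def)
  \<comment> \<open>Strictness is taken from this subtracted term; the sum of squares is only
    bounded by 1 non-strictly.\<close>
  moreover have "0 < 1 / real (length B)"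
    using True by (intro divide_pos_pos) linarith+
  ultimately show ?thesis
    using length_mult_Var[OF True] by linarith
qed (simp add: Var_def)

text \<open>Entries of a query sum to 1, so those of the scaled vector sum to
  \<open>card C'\<close>. Extending a prefix by positive entries cannot lower this total.\<close>

lemma nontrivial_prefix_card_le:
  assumes "(C', B) \<in> query_space" and "(C'', B') \<in> query_space"
    and "nontrivial_prefix (scale (real (card C')) B) (scale (real (card C'')) B')"
  shows "card C' \<le> card C''"
proof -
  have len: "length B < length B'"
    and eq: "\<And>i. i < length B \<Longrightarrow> real (card C') * B ! i = real (card C'') * B' ! i"
    using assms(3) by (auto simp: nontrivial_prefix_def scale_def)
  have "real (card C') = (\<Sum>i<length B. real (card C') * B ! i)"
    using assms(1) by (simp add: query_space_def flip: sum_distrib_left)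
  also have "\<dots> = (\<Sum>i<length B. real (card C'') * B' ! i)"
    using eq by (intro sum.cong) auto
  also have "\<dots> \<le> (\<Sum>i<length B'. real (card C'') * B' ! i)"
    using assms(2) len by (intro sum_mono2) (auto simp: query_space_def less_imp_le)
  also have "\<dots> = real (card C'')"
    using assms(2) by (simp add: query_space_def flip: sum_distrib_left)
  finally show ?thesis
    by simp
qed

theorem theorem1:
  fixes cost :: "'a query \<Rightarrow> real"
  assumes "\<And>C' B. (C', B) \<in> query_space \<Longrightarrow>
    cost (C', B) = (if length B \<le> 1 \<or> card C' \<le> 1 then 0
      else real (card C') * real (length B) * (1 - Var B))"
  shows "cost_function cost \<and> empty_questions cost \<and> prefix_monotonicity cost \<and>
    multiple_monotonicity cost \<and> variance_monotonicity cost"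
proof -
  have length_le: "1 \<le> length B" "length B \<le> card C'" if "(C', B) \<in> query_space"
    for C' :: "'a set" and B
    using that by (auto simp: query_space_def)
  have cost_trivial: "cost (C', B) = 0" if "(C', B) \<in> query_space" "length B \<le> 1" for C' B
    using that assms by simp
  \<comment> \<open>The test on \<open>card C'\<close> disappears because
    \<open>length B \<le> card C'\<close>.\<close>
  have cost_eq: "cost (C', B) = real (card C') * real (length B) * (1 - Var B)"
    if "(C', B) \<in> query_space" "1 < length B" for C' B
    using that assms length_le[OF that(1)] by simp
  have cost_lower: "real (card C') * (real (length B) - 1) < cost (C', B)"
    if Q: "(C', B) \<in> query_space" and l: "1 < length B" for C' B
  proof -
    have "real (card C') * (real (length B) - 1)
        < real (card C') * (real (length B) - real (length B) * Var B)"
      using length_mult_Var_less_1[OF Q] length_le[OF Q] l by (intro mult_strict_left_mono) auto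
    then show ?thesis
      using cost_eq[OF Q l] by (simp add: algebra_simps)
  qed
  have cost_nonneg: "0 \<le> cost (C', B)" if Q: "(C', B) \<in> query_space" for C' B
  proof (cases "1 < length B")
    case True
    then have "0 \<le> real (card C') * (real (length B) - 1)"
      by simp
    with cost_lower[OF Q True] show ?thesis
      by linarith
  qed (use Q cost_trivial in simp)
  have cost_upper: "cost (C', B) \<le> real (card C') * real (length B)"
    if Q: "(C', B) \<in> query_space" and l: "1 < length B" for C' B
    using cost_eq[OF Q l] Var_nonneg[of B] by (simp add: mult_left_le)
  have "cost_function cost"
    using cost_nonneg by (auto simp: cost_function_def)
  moreover have "empty_questions cost"
    using assms by (auto simp: empty_questions_def)
  moreover have "prefix_monotonicity cost"
    unfolding prefix_monotonicity_def
  proof (intro allI impI)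
    fix C' C'' :: "'a set" and B B'
    assume Q: "(C', B) \<in> query_space" and Q': "(C'', B') \<in> query_space"
      and prefix: "nontrivial_prefix (scale (real (card C')) B) (scale (real (card C'')) B')"
    have len: "length B < length B'"
      using prefix by (simp add: nontrivial_prefix_def scale_def)
    then have l': "1 < length B'"
      using length_le(1)[OF Q] by simp
    show "cost (C', B) < cost (C'', B')"
    proof (cases "1 < length B")
      case True
      have "cost (C', B) \<le> real (card C') * real (length B)"
        by (rule cost_upper[OF Q True])
      \<comment> \<open>Lengths are integers, so \<open>length B < length B'\<close> leaves a gap of
        at least one, which absorbs the largest possible variance loss of the longer vector.\<close>
      also have "\<dots> \<le> real (card C'') * (real (length B') - 1)"
        using nontrivial_prefix_card_le[OF Q Q' prefix] len by (intro mult_mono) auto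
      also have "\<dots> < cost (C'', B')"
        by (rule cost_lower[OF Q' l'])
      finally show ?thesis .
    next
      \<comment> \<open>A one-entry prefix costs 0 by convention, so positivity of the other cost
        suffices; it follows from \<open>length B' \<ge> 2\<close>.\<close>
      case False
      then have "cost (C', B) = 0"
        using cost_trivial[OF Q] by simp
      also have "0 \<le> real (card C'') * (real (length B') - 1)"
        using l' by simp
      also have "\<dots> < cost (C'', B')"
        by (rule cost_lower[OF Q' l'])
      finally show ?thesis .
    qed
  qed
  moreover have "multiple_monotonicity cost"
    unfolding multiple_monotonicity_def
  proof (intro ballI allI impI)
    fix Q Q' :: "'a query" and l :: nat
    assume Q: "Q \<in> query_space" and Q': "Q' \<in> query_space" and "is_multiple Q' Q l"
    then obtain C' C'' B where [simp]: "Q = (C', B)" "Q' = (C'', B)"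
      and card: "card C'' = l * card C'"
      by (cases Q, cases Q') (auto simp: is_multiple_def)
    \<comment> \<open>Equality holds: with \<open>B\<close> fixed, the cost is either 0 for both
      queries or proportional to the number of candidates.\<close>
    show "cost Q' \<ge> real l * cost Q"
      using Q Q' card cost_trivial cost_eq by (cases "1 < length B") auto
  qed
  moreover have "variance_monotonicity cost"
    unfolding variance_monotonicity_def
  proof (intro allI impI)
    fix C' :: "'a set" and B B'
    assume Q: "(C', B) \<in> query_space" and Q': "(C', B') \<in> query_space"
      and len: "length B = length B'" and Var: "Var B > Var B'"
    \<comment> \<open>On lengths at most 1 both variances take the default value 0, which excludes a
      strict inequality.\<close>
    have l: "1 < length B"
      using Var len by (auto simp: Var_def split: if_splits)
    then show "cost (C', B) < cost (C', B')"
      using cost_eq[OF Q] cost_eq[OF Q'] len length_le[OF Q] Var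
      by (auto intro!: mult_strict_left_mono)
  qed
  ultimately show ?thesis
    by blast
qed

end
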